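(* Let $\hbar>0$, $x>1$, $\eta>0$, $\Sigma=\nu\mathbb 1_2$ with $\nu=x\hbar/2$, and $\ell_{\rm BW}=\eta\hbar$. Consider the three quadratic forms on $\operatorname{Sym}(2)$ $$g_{\rm B}^*(P,P)=8\operatorname{Tr}(P\Sigma P\Sigma)+2\hbar^2\operatorname{Tr}(P\Omega P\Omega),\quad \mathcal B_\Sigma(P,P)=8\operatorname{Tr}(P\Sigma P\Sigma),\quad \widetilde g_{\rm BW}^*(P,P)=4\ell_{\rm BW}\operatorname{Tr}(P\Sigma P).$$ Their determinants in a trace-orthonormal basis of $\operatorname{Sym}(2)$, divided by $8\hbar^6$, are respectively $$\Delta_{\rm B}=(x^2-1)(x^2+1)^2,\qquad \Delta_{\rm FR}=x^6,\qquad \Delta_{\rm BW}=\eta^3x^3 .$$ The point $(x,\eta)=(\sqrt{\varphi},\sqrt{\varphi})$, where $\varphi=(1+\sqrt5)/2$, is the unique point at which all three determinant densities coincide, and there $$\Delta_{\rm B}=\Delta_{\rm FR}=\Delta_{\rm BW}=\varphi^3 .$$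
   Context: $\operatorname{Sym}(2)$ is the space of real symmetric $2\times2$ matrices with trace pairing $\langle P,Q\rangle=\operatorname{Tr}(PQ)$, and $\Omega=\begin{pmatrix}0&1\\-1&0\end{pmatrix}$. The forms are, respectively, the Gaussian quantum Bures cometric, the lift-normalized covariance Fisher--Rao cometric, and the Bures--Wasserstein cometric multiplied by an action scale $\ell_{\rm BW}>0$; $\eta=\ell_{\rm BW}/\hbar$ is a constant action-matching parameter. $x=2\nu/\hbar$ is the floor-normalized symplectic eigenvalue. *)

theory Defs
  imports "HOL-Analysis.Analysis"
begin

definition Sym2 :: "(real^2^2) set" where
  "Sym2 = {P. transpose P = P}"

definition trace_pairing :: "real^2^2 \<Rightarrow> real^2^2 \<Rightarrow> real" where
  "trace_pairing P Q = trace (P ** Q)"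

definition Omega :: "real^2^2" where
  "Omega = vector [vector [0, 1], vector [- 1, 0]]"

definition bures_cometric :: "real \<Rightarrow> real^2^2 \<Rightarrow> real^2^2 \<Rightarrow> real" where
  "bures_cometric hbar \<Sigma> P =
     8 * trace (P ** \<Sigma> ** P ** \<Sigma>) + 2 * hbar\<^sup>2 * trace (P ** Omega ** P ** Omega)"

definition fisher_rao_cometric :: "real^2^2 \<Rightarrow> real^2^2 \<Rightarrow> real" where
  "fisher_rao_cometric \<Sigma> P = 8 * trace (P ** \<Sigma> ** P ** \<Sigma>)"

definition bures_wasserstein_cometric :: "real \<Rightarrow> real^2^2 \<Rightarrow> real^2^2 \<Rightarrow> real" where
  "bures_wasserstein_cometric l \<Sigma> P = 4 * l * trace (P ** \<Sigma> ** P)"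

definition polarization :: "(real^2^2 \<Rightarrow> real) \<Rightarrow> real^2^2 \<Rightarrow> real^2^2 \<Rightarrow> real" where
  "polarization q P Q = (q (P + Q) - q P - q Q) / 2"

definition trace_orthonormal_basis :: "(3 \<Rightarrow> real^2^2) \<Rightarrow> bool" where
  "trace_orthonormal_basis E \<longleftrightarrow>
     span (range E) = Sym2 \<and>
     (\<forall>i j. trace_pairing (E i) (E j) = (if i = j then 1 else 0))"

text \<open>The determinant of a quadratic form is that of the Gram matrix of its polar
  bilinear form, so that the polarization at \<open>(P, P)\<close> is the form at \<open>P\<close>.\<close>

definition form_det :: "(3 \<Rightarrow> real^2^2) \<Rightarrow> (real^2^2 \<Rightarrow> real) \<Rightarrow> real" where
  "form_det E q = det (\<chi> i j. polarization q (E i) (E j))"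

definition covariance :: "real \<Rightarrow> real \<Rightarrow> real^2^2" where
  "covariance hbar x = (let \<nu> = x * hbar / 2 in mat \<nu>)"

definition Delta_B :: "real \<Rightarrow> (3 \<Rightarrow> real^2^2) \<Rightarrow> real \<Rightarrow> real" where
  "Delta_B hbar E x = form_det E (bures_cometric hbar (covariance hbar x)) / (8 * hbar ^ 6)"

definition Delta_FR :: "real \<Rightarrow> (3 \<Rightarrow> real^2^2) \<Rightarrow> real \<Rightarrow> real" where
  "Delta_FR hbar E x = form_det E (fisher_rao_cometric (covariance hbar x)) / (8 * hbar ^ 6)"

definition Delta_BW :: "real \<Rightarrow> (3 \<Rightarrow> real^2^2) \<Rightarrow> real \<Rightarrow> real \<Rightarrow> real" where
  "Delta_BW hbar E x \<eta> =
     form_det E (bures_wasserstein_cometric (\<eta> * hbar) (covariance hbar x)) / (8 * hbar ^ 6)"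

definition golden_ratio :: real where
  "golden_ratio = (1 + sqrt 5) / 2"

text \<open>Trace-orthonormal bases exist, so statements about all of them are not vacuous.\<close>

lemma trace_orthonormal_basis_exists: "\<exists>E. trace_orthonormal_basis E"
proof -
  let ?r = "1 / sqrt 2 :: real"
  define A B C :: "real^2^2" where
    "A = vector [vector [1, 0], vector [0, 0]]" and
    "B = vector [vector [0, 0], vector [0, 1]]" and
    "C = vector [vector [0, ?r], vector [?r, 0]]"
  define E :: "3 \<Rightarrow> real^2^2" where
    "E = (\<lambda>i. if i = 1 then A else if i = 2 then B else C)"
  have E: "E 1 = A" "E 2 = B" "E 3 = C" by (simp_all add: E_def)
  have range_E: "range E = {A, B, C}"
    by (simp add: UNIV_3 E)
  have "P \<in> span {A, B, C}" if "P \<in> Sym2" for P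
  proof -
    have "P $ 1 $ 2 = P $ 2 $ 1"
    proof -
      have "transpose P $ 1 $ 2 = P $ 1 $ 2"
        using that by (simp only: Sym2_def mem_Collect_eq)
      then show ?thesis by (simp only: transpose_def vec_lambda_beta)
    qed
    then have "P = (P $ 1 $ 1) *\<^sub>R A + (P $ 2 $ 2) *\<^sub>R B + (sqrt 2 * P $ 1 $ 2) *\<^sub>R C"
      by (simp add: A_def B_def C_def vec_eq_iff forall_2)
    also have "\<dots> \<in> span {A, B, C}"
      by (intro span_add span_scale span_base) auto
    finally show ?thesis .
  qed
  moreover have "subspace Sym2"
    by (auto simp: subspace_def Sym2_def transpose_def vec_eq_iff)
  moreover have "{A, B, C} \<subseteq> Sym2"
    by (auto simp: A_def B_def C_def Sym2_def transpose_def vec_eq_iff forall_2)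
  ultimately have "span (range E) = Sym2"
    unfolding range_E by (metis subset_antisym span_minimal subsetI)
  moreover have "trace_pairing (E i) (E j) = (if i = j then 1 else 0)" for i j
    using exhaust_3[of i] exhaust_3[of j]
    by (auto simp: E trace_pairing_def trace_def matrix_matrix_mult_def sum_2 A_def B_def C_def)
  ultimately show ?thesis
    unfolding trace_orthonormal_basis_def by blast
qed

end

(* On Sym(2) all three forms have the shape a Tr(P^2) - b (Tr P)^2: for symmetric P,
   Tr(P Omega P Omega) = -2 det P = Tr(P^2) - (Tr P)^2.  In a trace-orthonormal basis E the
   Gram matrix is a I - b t t^T with t_i = Tr E_i, and expanding the identity matrix
   in E gives |t|^2 = Tr 1 = 2; hence the determinant is a^2 (a - 2b).  With y = x^2 the
   first two densities agree iff y^2 = y + 1. *)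

theory Submission imports Defs begin

lemma Sym2_subspace: "subspace Sym2"
  by (auto simp: subspace_def Sym2_def transpose_def vec_eq_iff)

lemma Sym2_offdiag: "P \<in> Sym2 \<Longrightarrow> P $ 2 $ 1 = P $ 1 $ 2"
  by (metis (mono_tags) Sym2_def mem_Collect_eq transpose_def vec_lambda_beta)

lemma trace_pairing_entries:
  "trace_pairing P Q =
     P $ 1 $ 1 * Q $ 1 $ 1 + P $ 1 $ 2 * Q $ 2 $ 1 + P $ 2 $ 1 * Q $ 1 $ 2 + P $ 2 $ 2 * Q $ 2 $ 2"
  by (simp add: trace_pairing_def trace_def matrix_matrix_mult_def sum_2)

text \<open>The shape of \<open>q\<close> is assumed only on \<open>Sym2\<close>, because the Bures
  form has it only there. Closure of \<open>Sym2\<close> under addition allows the assumption to be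
  used at \<open>P + Q\<close> as well.\<close>

lemma polarization_trace_form:
  assumes q: "\<And>P. P \<in> Sym2 \<Longrightarrow> q P = a * trace_pairing P P - b * (trace P)\<^sup>2"
    and "P \<in> Sym2" "Q \<in> Sym2"
  shows "polarization q P Q = a * trace_pairing P Q - b * (trace P * trace Q)"
proof -
  have "P + Q \<in> Sym2"
    using Sym2_subspace assms(2,3) by (rule subspace_add)
  moreover have "trace_pairing (P + Q) (P + Q) =
      trace_pairing P P + 2 * trace_pairing P Q + trace_pairing Q Q"
    by (simp add: trace_pairing_entries algebra_simps)
  ultimately show ?thesis
    by (simp add: polarization_def q assms(2,3) trace_add power2_eq_square field_simps)
qed

lemma trace_orthonormal_basis_sum_traces:
  assumes "trace_orthonormal_basis E"
  shows "(\<Sum>i\<in>UNIV. (trace (E i))\<^sup>2) = 2"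
proof -
  have orth: "trace_pairing (E i) (E j) = (if i = j then 1 else 0)" for i j
    using assms by (auto simp: trace_orthonormal_basis_def)
  \<comment> \<open>Injectivity turns a combination over the set \<open>range E\<close> into a sum
    over the three indices.\<close>
  have "inj E"
    using orth by (metis injI zero_neq_one)
  have "mat 1 \<in> span (range E)"
    using assms by (simp add: trace_orthonormal_basis_def Sym2_def)
  then obtain u where "mat 1 = (\<Sum>v\<in>range E. u v *\<^sub>R v)"
    by (auto simp: span_finite)
  then have one: "mat 1 = (\<Sum>i\<in>UNIV. u (E i) *\<^sub>R E i)"
    using \<open>inj E\<close> by (simp add: sum.reindex)
  \<comment> \<open>Orthonormality isolates the coefficient of \<open>E j\<close>. Since pairing
    with the identity is the trace, that coefficient is \<open>trace (E j)\<close>.\<close>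
  have "trace_pairing (mat 1) (E j) = u (E j)" for j
  proof -
    have "trace_pairing (\<Sum>i\<in>UNIV. u (E i) *\<^sub>R E i) (E j) =
        (\<Sum>i\<in>UNIV. u (E i) * trace_pairing (E i) (E j))"
      by (simp add: trace_pairing_entries sum_3 algebra_simps)
    then show ?thesis
      by (simp add: one orth if_distrib cong: if_cong)
  qed
  then have u: "u (E j) = trace (E j)" for j
    by (simp add: trace_pairing_def)
  have "2 = trace (mat 1 :: real^2^2)"
    by (simp add: trace_def mat_def)
  also have "\<dots> = (\<Sum>i\<in>UNIV. (trace (E i))\<^sup>2)"
    by (simp add: one u trace_def sum_3 sum_2 power2_eq_square algebra_simps)
  finally show ?thesis ..
qed

lemma form_det_trace_form:
  assumes E: "trace_orthonormal_basis E"
    and q: "\<And>P. P \<in> Sym2 \<Longrightarrow> q P = a * trace_pairing P P - b * (trace P)\<^sup>2"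
  shows "form_det E q = a\<^sup>2 * (a - 2 * b)"
proof -
  have "E i \<in> Sym2" for i
    using E by (metis rangeI span_base trace_orthonormal_basis_def)
  then have "polarization q (E i) (E j) =
      a * (if i = j then 1 else 0) - b * (trace (E i) * trace (E j))" for i j
    using E polarization_trace_form[OF q] by (simp add: trace_orthonormal_basis_def)
  \<comment> \<open>Matrix determinant lemma for a rank-one perturbation of \<open>a\<close> times
    the identity, checked by expanding the 3 by 3 determinant. In this polynomial form it also
    covers \<open>a = 0\<close>.\<close>
  then have "form_det E q = a\<^sup>2 * (a - b * (\<Sum>i\<in>UNIV. (trace (E i))\<^sup>2))"
    by (simp add: form_det_def det_3 sum_3) (simp add: power2_eq_square algebra_simps)
  then show ?thesis
    by (simp add: trace_orthonormal_basis_sum_traces[OF E])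
qed

lemma covariance_mult: "P ** covariance hbar x = (x * hbar / 2) *\<^sub>R P"
  by (simp add: covariance_def Let_def vec_eq_iff forall_2 matrix_matrix_mult_def mat_def sum_2)

text \<open>A scalar covariance factors out of the trace, and 8 (x hbar / 2)^2 = 2 hbar^2 x^2. This
  is the common shape with b = 0.\<close>

lemma fisher_rao_cometric_covariance:
  "fisher_rao_cometric (covariance hbar x) P = 2 * hbar\<^sup>2 * x\<^sup>2 * trace_pairing P P"
  unfolding fisher_rao_cometric_def covariance_mult
  by (simp add: trace_pairing_entries trace_def sum_2
      matrix_matrix_mult_def power2_eq_square field_simps)

lemma bures_wasserstein_cometric_covariance:
  "bures_wasserstein_cometric (\<eta> * hbar) (covariance hbar x) P =
     2 * hbar\<^sup>2 * (\<eta> * x) * trace_pairing P P"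
  unfolding bures_wasserstein_cometric_def covariance_mult
  by (simp add: trace_pairing_entries trace_def sum_2
      matrix_matrix_mult_def power2_eq_square field_simps)

text \<open>For symmetric \<open>P\<close>, Omega P Omega is minus the adjugate of \<open>P\<close>,
  so the product under the trace is -(det P) times the identity. Cayley-Hamilton gives 2 det P = (Tr
  P)^2 - Tr(P^2).\<close>

lemma trace_Omega_Sym2:
  "P \<in> Sym2 \<Longrightarrow> trace (P ** Omega ** P ** Omega) = trace_pairing P P - (trace P)\<^sup>2"
  by (simp add: trace_pairing_entries trace_def sum_2 matrix_matrix_mult_def Omega_def
      Sym2_offdiag power2_eq_square algebra_simps)

lemma bures_cometric_covariance:
  "P \<in> Sym2 \<Longrightarrow> bures_cometric hbar (covariance hbar x) P =
     2 * hbar\<^sup>2 * (x\<^sup>2 + 1) * trace_pairing P P - 2 * hbar\<^sup>2 * (trace P)\<^sup>2"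
  using fisher_rao_cometric_covariance[of hbar x P]
  by (simp add: bures_cometric_def fisher_rao_cometric_def trace_Omega_Sym2 algebra_simps)

lemma Delta_B_eq:
  assumes "hbar \<noteq> 0" "trace_orthonormal_basis E"
  shows "Delta_B hbar E x = (x\<^sup>2 - 1) * (x\<^sup>2 + 1)\<^sup>2"
proof -
  \<comment> \<open>Here b = 2 hbar^2, so the simple eigenvalue a - 2b of the Gram matrix is 2
    hbar^2 (x^2 - 1), the factor that vanishes at x = 1.\<close>
  have "form_det E (bures_cometric hbar (covariance hbar x)) =
      (2 * hbar\<^sup>2 * (x\<^sup>2 + 1))\<^sup>2 * (2 * hbar\<^sup>2 * (x\<^sup>2 + 1) - 2 * (2 * hbar\<^sup>2))"
    using assms(2) bures_cometric_covariance by (rule form_det_trace_form)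
  also have "\<dots> = 8 * hbar ^ 6 * ((x\<^sup>2 - 1) * (x\<^sup>2 + 1)\<^sup>2)"
    by (simp add: eval_nat_numeral algebra_simps)
  finally show ?thesis
    using assms(1) by (simp add: Delta_B_def)
qed

lemma Delta_FR_eq:
  assumes "hbar \<noteq> 0" "trace_orthonormal_basis E"
  shows "Delta_FR hbar E x = x ^ 6"
proof -
  \<comment> \<open>The unsimplified \<open>- 2 * 0\<close> lets the rule match with b = 0.\<close>
  have "form_det E (fisher_rao_cometric (covariance hbar x)) =
      (2 * hbar\<^sup>2 * x\<^sup>2)\<^sup>2 * (2 * hbar\<^sup>2 * x\<^sup>2 - 2 * 0)"
    using assms(2) by (rule form_det_trace_form) (simp add: fisher_rao_cometric_covariance)
  also have "\<dots> = 8 * hbar ^ 6 * x ^ 6"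
    by (simp add: eval_nat_numeral algebra_simps)
  finally show ?thesis
    using assms(1) by (simp add: Delta_FR_def)
qed

lemma Delta_BW_eq:
  assumes "hbar \<noteq> 0" "trace_orthonormal_basis E"
  shows "Delta_BW hbar E x \<eta> = \<eta> ^ 3 * x ^ 3"
proof -
  have "form_det E (bures_wasserstein_cometric (\<eta> * hbar) (covariance hbar x)) =
      (2 * hbar\<^sup>2 * (\<eta> * x))\<^sup>2 * (2 * hbar\<^sup>2 * (\<eta> * x) - 2 * 0)"
    using assms(2) by (rule form_det_trace_form) (simp add: bures_wasserstein_cometric_covariance)
  also have "\<dots> = 8 * hbar ^ 6 * (\<eta> ^ 3 * x ^ 3)"
    by (simp add: eval_nat_numeral algebra_simps)
  finally show ?thesis
    using assms(1) by (simp add: Delta_BW_def)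
qed

lemma golden_ratio_gt_1: "golden_ratio > 1"
  by (simp add: golden_ratio_def)

lemma golden_ratio_square: "golden_ratio\<^sup>2 = golden_ratio + 1"
  by (simp add: golden_ratio_def power2_eq_square field_simps)

lemma golden_ratio_unique:
  assumes "y > 0" "y\<^sup>2 = y + 1"
  shows "y = golden_ratio"
proof -
  \<comment> \<open>Difference of the two quadratic equations, factored. The second factor is
    positive because y > 0 and \<open>golden_ratio\<close> exceeds 1.\<close>
  have "(y - golden_ratio) * (y + golden_ratio - 1) = 0"
    using assms(2) golden_ratio_square by (simp add: power2_eq_square algebra_simps)
  then show ?thesis
    using assms(1) golden_ratio_gt_1 by simp
qed

lemma bures_fisher_rao_eq_iff:
  fixes x :: real
  assumes "x > 0"
  shows "(x\<^sup>2 - 1) * (x\<^sup>2 + 1)\<^sup>2 = x ^ 6 \<longleftrightarrow> x = sqrt golden_ratio"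
proof -
  \<comment> \<open>The sextic terms cancel, leaving a quadratic in x^2.\<close>
  have "(x\<^sup>2 - 1) * (x\<^sup>2 + 1)\<^sup>2 - x ^ 6 = (x\<^sup>2)\<^sup>2 - (x\<^sup>2 + 1)"
    by (simp add: eval_nat_numeral algebra_simps)
  then have "(x\<^sup>2 - 1) * (x\<^sup>2 + 1)\<^sup>2 = x ^ 6 \<longleftrightarrow> (x\<^sup>2)\<^sup>2 = x\<^sup>2 + 1"
    by linarith
  also have "\<dots> \<longleftrightarrow> x\<^sup>2 = golden_ratio"
    using golden_ratio_unique golden_ratio_square zero_less_power[OF assms] by metis
  also have "\<dots> \<longleftrightarrow> x = sqrt golden_ratio"
    using assms golden_ratio_gt_1 by (auto intro: real_sqrt_unique[symmetric])
  finally show ?thesis .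
qed

theorem mainTheorem13:
  fixes hbar :: real and E :: "3 \<Rightarrow> real^2^2"
  assumes "hbar > 0" and "trace_orthonormal_basis E"
  shows
    "(\<forall>x \<eta>. 1 < x \<and> 0 < \<eta> \<longrightarrow>
        Delta_B hbar E x = (x\<^sup>2 - 1) * (x\<^sup>2 + 1)\<^sup>2 \<and>
        Delta_FR hbar E x = x ^ 6 \<and>
        Delta_BW hbar E x \<eta> = \<eta> ^ 3 * x ^ 3) \<and>
     {(x, \<eta>). 1 < x \<and> 0 < \<eta> \<and>
        Delta_B hbar E x = Delta_FR hbar E x \<and>
        Delta_FR hbar E x = Delta_BW hbar E x \<eta>}
       = {(sqrt golden_ratio, sqrt golden_ratio)} \<and>
     Delta_B hbar E (sqrt golden_ratio) = golden_ratio ^ 3 \<and>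
     Delta_FR hbar E (sqrt golden_ratio) = golden_ratio ^ 3 \<and>
     Delta_BW hbar E (sqrt golden_ratio) (sqrt golden_ratio) = golden_ratio ^ 3"
proof -
  let ?s = "sqrt golden_ratio"
  have "hbar \<noteq> 0"
    using assms(1) by simp
  note Delta = Delta_B_eq[OF this assms(2)] Delta_FR_eq[OF this assms(2)]
    Delta_BW_eq[OF this assms(2)]
  have s: "?s > 1"
    using golden_ratio_gt_1 by simp
  have "?s ^ 6 = (?s\<^sup>2) ^ 3"
    by (simp flip: power_mult)
  then have s6: "?s ^ 6 = golden_ratio ^ 3"
    using golden_ratio_gt_1 by simp
  \<comment> \<open>On the diagonal where both parameters equal \<open>?s\<close>, the
    Bures-Wasserstein density becomes the Fisher-Rao one.\<close>
  have s33: "?s ^ 3 * ?s ^ 3 = ?s ^ 6"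
    by (simp flip: power_add)
  have B: "(?s\<^sup>2 - 1) * (?s\<^sup>2 + 1)\<^sup>2 = ?s ^ 6"
    using bures_fisher_rao_eq_iff[of ?s] s by simp
  \<comment> \<open>Fisher-Rao and Bures-Wasserstein agree only on the diagonal: cancel x^3, then
    use injectivity of the cube on positive reals. The golden ratio enters only through the Bures
    density.\<close>
  have BW: "\<eta> = x" if "0 < x" "0 < \<eta>" "x ^ 6 = \<eta> ^ 3 * x ^ 3" for x \<eta> :: real
  proof -
    have "x ^ 3 * x ^ 3 = \<eta> ^ 3 * x ^ 3"
      unfolding that(3)[symmetric] by (simp flip: power_add)
    moreover have "x ^ 3 \<noteq> 0"
      using that(1) by simp
    ultimately have "x ^ 3 = \<eta> ^ 3"
      using mult_right_cancel by blast
    then show ?thesis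
      using that(1,2) by (simp add: power_eq_iff_eq_base)
  qed
  have "{(x, \<eta>). 1 < x \<and> 0 < \<eta> \<and>
        Delta_B hbar E x = Delta_FR hbar E x \<and>
        Delta_FR hbar E x = Delta_BW hbar E x \<eta>} = {(?s, ?s)}" (is "?S = _")
  proof (intro equalityI subsetI)
    fix p assume "p \<in> ?S"
    then obtain x \<eta> where p: "p = (x, \<eta>)" "1 < x" "0 < \<eta>"
        "(x\<^sup>2 - 1) * (x\<^sup>2 + 1)\<^sup>2 = x ^ 6" "x ^ 6 = \<eta> ^ 3 * x ^ 3"
      by (auto simp: Delta)
    have "x > 0"
      using p(2) by simp
    then have "x = ?s" "\<eta> = x"
      using bures_fisher_rao_eq_iff p(4) BW p(3,5) by blast+
    then show "p \<in> {(?s, ?s)}"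
      using p(1) by blast
  next
    fix p assume "p \<in> {(?s, ?s)}"
    then show "p \<in> ?S"
      using s B s33 by (auto simp: Delta)
  qed
  then show ?thesis
    by (simp only: Delta B s33 s6 simp_thms)
qed

end
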